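(* Let $p,q$ be positive integers, and let $\{n_\alpha\}_{1\le \alpha\le p}$ and $\{m_\beta\}_{1\le \beta\le q}$ be sequences of positive integers. Set $n=\sum_{\alpha=1}^p n_\alpha$ and $m=\sum_{\beta=1}^q m_\beta$. Then there exists a degeneration between direct sums of matrix multiplication tensors: \[ \langle n,1,m\rangle \oplus \bigoplus_{\substack{1\le \alpha\le p\\1\le \beta\le q}} \langle 1,(n_\alpha-1)(m_\beta-1),1\rangle \ \trianglelefteq\ \langle nm\rangle \oplus \langle p,1,q\rangle. \]
   Context: $\langle n,m,p\rangle = \sum_{i,j,k} x_{ij}y_{jk}z_{ki}$ is the matrix multiplication tensor, $\langle r\rangle$ the diagonal tensor of size $r$, $\trianglelefteq$ degeneration, $\oplus$ direct sum. *)

theory Defs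
  imports "HOL-Computational_Algebra.Polynomial"
begin

text \<open>
  A tensor in \<open>F\<^sup>I \<otimes> F\<^sup>J \<otimes> F\<^sup>K\<close>, given by its three finite index sets and its coefficients in
  the standard bases; it stands for the trilinear form
  \<open>\<Sum>i\<in>I. \<Sum>j\<in>J. \<Sum>k\<in>K. T i j k * x i * y j * z k\<close>.  Coefficients at indices outside
  \<open>I \<times> J \<times> K\<close> are junk and are never looked at.
\<close>

datatype ('i, 'j, 'k, 'a) tensor =
  Tensor (idx1: "'i set") (idx2: "'j set") (idx3: "'k set") (cf: "'i \<Rightarrow> 'j \<Rightarrow> 'k \<Rightarrow> 'a")

definition finite_tensor :: "('i, 'j, 'k, 'a) tensor \<Rightarrow> bool" where
  "finite_tensor T \<longleftrightarrow> finite (idx1 T) \<and> finite (idx2 T) \<and> finite (idx3 T)"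

text \<open>The three index sets are those of the variables \<open>x\<^sub>i\<^sub>j\<close>, \<open>y\<^sub>j\<^sub>k\<close> and \<open>z\<^sub>k\<^sub>i\<close>, in this order.\<close>

definition matmul_tensor ::
    "nat \<Rightarrow> nat \<Rightarrow> nat \<Rightarrow> (nat \<times> nat, nat \<times> nat, nat \<times> nat, 'a::zero_neq_one) tensor" where
  "matmul_tensor n m p =
     Tensor ({1..n} \<times> {1..m}) ({1..m} \<times> {1..p}) ({1..p} \<times> {1..n})
       (\<lambda>(i, j) (j', k) (k', i'). if i = i' \<and> j = j' \<and> k = k' then 1 else 0)"

definition diag_tensor :: "nat \<Rightarrow> (nat, nat, nat, 'a::zero_neq_one) tensor" where
  "diag_tensor r = Tensor {1..r} {1..r} {1..r} (\<lambda>i j k. if i = j \<and> j = k then 1 else 0)"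

definition tensor_plus ::
    "('i, 'j, 'k, 'a::zero) tensor \<Rightarrow> ('i', 'j', 'k', 'a) tensor \<Rightarrow>
     ('i + 'i', 'j + 'j', 'k + 'k', 'a) tensor"  (infixr "\<oplus>" 65) where
  "S \<oplus> T =
     Tensor (idx1 S <+> idx1 T) (idx2 S <+> idx2 T) (idx3 S <+> idx3 T)
       (\<lambda>i j k. case (i, j, k) of
          (Inl i, Inl j, Inl k) \<Rightarrow> cf S i j k
        | (Inr i, Inr j, Inr k) \<Rightarrow> cf T i j k
        | _ \<Rightarrow> 0)"

definition tensor_dsum ::
    "'s set \<Rightarrow> ('s \<Rightarrow> ('i, 'j, 'k, 'a::zero) tensor) \<Rightarrow>
     ('s \<times> 'i, 's \<times> 'j, 's \<times> 'k, 'a) tensor" where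
  "tensor_dsum A T =
     Tensor (SIGMA s:A. idx1 (T s)) (SIGMA s:A. idx2 (T s)) (SIGMA s:A. idx3 (T s))
       (\<lambda>(s, i) (s', j) (s'', k). if s = s' \<and> s' = s'' then cf (T s) i j k else 0)"

text \<open>
  \<open>T\<close> is a degeneration of \<open>S\<close> if there are linear maps \<open>A\<close>, \<open>B\<close>, \<open>C\<close> depending polynomially on a
  parameter \<open>\<epsilon>\<close> (matrices over \<open>F[\<epsilon>]\<close>) and some \<open>d\<close> with
  \<open>(A \<otimes> B \<otimes> C) S = \<epsilon>\<^sup>d T + O(\<epsilon>\<^sup>d\<^sup>+\<^sup>1)\<close>.  Here \<open>monom c d\<close> is \<open>c \<epsilon>\<^sup>d\<close>, and \<open>R\<close> is the
  tensor over \<open>F[\<epsilon>]\<close> hidden in the error term.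
\<close>

definition degeneration ::
    "('i, 'j, 'k, 'a::field) tensor \<Rightarrow> ('i', 'j', 'k', 'a) tensor \<Rightarrow> bool"  (infix "\<unlhd>" 50) where
  "T \<unlhd> S \<longleftrightarrow> finite_tensor T \<and> finite_tensor S \<and>
     (\<exists>(A :: 'i \<Rightarrow> 'i' \<Rightarrow> 'a poly) (B :: 'j \<Rightarrow> 'j' \<Rightarrow> 'a poly) (C :: 'k \<Rightarrow> 'k' \<Rightarrow> 'a poly)
        (d :: nat) (R :: 'i \<Rightarrow> 'j \<Rightarrow> 'k \<Rightarrow> 'a poly).
        \<forall>i \<in> idx1 T. \<forall>j \<in> idx2 T. \<forall>k \<in> idx3 T.
          (\<Sum>i' \<in> idx1 S. \<Sum>j' \<in> idx2 S. \<Sum>k' \<in> idx3 S.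
             A i i' * B j j' * C k k' * [:cf S i' j' k':])
          = monom (cf T i j k) d + monom 1 (Suc d) * R i j k)"

end

theory Submission
  imports Defs
begin

text \<open>
  Cut the rows \<open>{1..n}\<close> into blocks of sizes \<open>n\<^sub>\<alpha>\<close> and the columns \<open>{1..m}\<close> into blocks of sizes
  \<open>m\<^sub>\<beta>\<close>, and write \<open>\<alpha>(i)\<close>, \<open>\<beta>(j)\<close> for the blocks of \<open>i\<close>, \<open>j\<close>.  Following Schoenhage, consider
  \[ \sum_{i,j} (x_i + \epsilon u_{ij}) (y_j + \epsilon v_{ij}) (\epsilon^2 z_{ji} + w_{\alpha(i)\beta(j)})
     - \sum_{\alpha,\beta} \Bigl(\sum_{i \in \alpha} x_i\Bigr) \Bigl(\sum_{j \in \beta} y_j\Bigr) w_{\alpha\beta}. \]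
  If in each block the columns of \<open>u\<close> and the rows of \<open>v\<close> sum to zero, the terms of order \<open>0\<close> and \<open>1\<close>
  cancel, and the term of order \<open>2\<close> is
  \<open>\<Sum>\<^sub>i\<^sub>j x\<^sub>i y\<^sub>j z\<^sub>j\<^sub>i + \<Sum>\<^sub>i\<^sub>j u\<^sub>i\<^sub>j v\<^sub>i\<^sub>j w\<^sub>\<alpha>\<^sub>\<beta>\<close>.  In each block the entries of \<open>u\<close> and \<open>v\<close>
  off the last row and the last column are free; the last row of \<open>u\<close> and the last column of \<open>v\<close>
  balance the sums, while the last column of \<open>u\<close> and the last row of \<open>v\<close> are zero.  Thus \<open>u v\<close>
  vanishes on the boundary of the block, which leaves \<open>(n\<^sub>\<alpha> - 1) (m\<^sub>\<beta> - 1)\<close> independent products.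
\<close>

text \<open>At the rows \<open>A i\<close>, \<open>B j\<close>, \<open>C k\<close> of the three
  matrices, this form is one entry of the transformed tensor, so a degeneration can be checked by
  substitution.\<close>

definition trilinear ::
    "('i, 'j, 'k, 'a::field) tensor \<Rightarrow> ('i \<Rightarrow> 'a poly) \<Rightarrow> ('j \<Rightarrow> 'a poly) \<Rightarrow> ('k \<Rightarrow> 'a poly) \<Rightarrow> 'a poly"
  where "trilinear S x y z =
    (\<Sum>i \<in> idx1 S. \<Sum>j \<in> idx2 S. \<Sum>k \<in> idx3 S. x i * y j * z k * [:cf S i j k:])"

lemma degenerationI:
  fixes T :: "('i, 'j, 'k, 'a::field) tensor" and S :: "('i', 'j', 'k', 'a) tensor"
  assumes "finite_tensor T" and "finite_tensor S"
    and dvd: "\<And>i j k. i \<in> idx1 T \<Longrightarrow> j \<in> idx2 T \<Longrightarrow> k \<in> idx3 T \<Longrightarrow>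
      monom 1 (Suc d) dvd trilinear S (A i) (B j) (C k) - monom (cf T i j k) d"
  shows "T \<unlhd> S"
proof -
  define R where "R i j k =
    (trilinear S (A i) (B j) (C k) - monom (cf T i j k) d) div monom 1 (Suc d)" for i j k
  have "trilinear S (A i) (B j) (C k) = monom (cf T i j k) d + monom 1 (Suc d) * R i j k"
    if "i \<in> idx1 T" "j \<in> idx2 T" "k \<in> idx3 T" for i j k
    using dvd[OF that] by (simp add: R_def)
  with assms(1,2) show ?thesis
    unfolding degeneration_def trilinear_def by blast
qed

lemma trilinear_plus:
  assumes "finite_tensor S" and "finite_tensor T"
  shows "trilinear (S \<oplus> T) x y z =
    trilinear S (x \<circ> Inl) (y \<circ> Inl) (z \<circ> Inl) + trilinear T (x \<circ> Inr) (y \<circ> Inr) (z \<circ> Inr)"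
  using assms by (simp add: trilinear_def tensor_plus_def finite_tensor_def sum.Plus)

lemma sum_of_bool_eq_mult:
  fixes g :: "'b \<Rightarrow> 'c::semiring_1"
  assumes "finite P" and "p \<in> P"
  shows "(\<Sum>x\<in>P. of_bool (x = p) * g x) = g p"
proof -
  have "(\<Sum>x\<in>P. of_bool (x = p) * g x) = (\<Sum>x\<in>P. if x = p then g x else 0)"
    by (rule sum.cong) auto
  with assms show ?thesis by simp
qed

lemma trilinear_diag:
  "trilinear (diag_tensor r) x y z = (\<Sum>i=1..r. x i * y i * z i)"
proof -
  have "trilinear (diag_tensor r) x y z =
     (\<Sum>i=1..r. \<Sum>j=1..r. \<Sum>k=1..r. of_bool (k = j) * (of_bool (j = i) * (x i * y j * z k)))"
    unfolding trilinear_def diag_tensor_def tensor.sel by (intro sum.cong refl) auto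
  also have "\<dots> = (\<Sum>i=1..r. x i * y i * z i)"
    by (simp add: sum_of_bool_eq_mult del: sum_of_bool_mult_eq sum_mult_of_bool_eq)
  finally show ?thesis .
qed

lemma trilinear_outer:
  "trilinear (matmul_tensor p 1 q) x y z = (\<Sum>a=1..p. \<Sum>b=1..q. x (a, 1) * y (1, b) * z (b, a))"
proof -
  have "trilinear (matmul_tensor p 1 q) x y z =
     (\<Sum>a=1..p. \<Sum>b=1..q. \<Sum>b'=1..q. \<Sum>a'=1..p.
       of_bool (a' = a) * (of_bool (b' = b) * (x (a, 1) * y (1, b) * z (b', a'))))"
    unfolding trilinear_def matmul_tensor_def tensor.sel sum.cartesian_product'
    by (simp del: sum_of_bool_mult_eq sum_mult_of_bool_eq) (intro sum.cong refl, auto)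
  also have "\<dots> = (\<Sum>a=1..p. \<Sum>b=1..q. x (a, 1) * y (1, b) * z (b, a))"
    by (simp add: sum_of_bool_eq_mult del: sum_of_bool_mult_eq sum_mult_of_bool_eq)
  finally show ?thesis .
qed

lemma finite_tensor_matmul: "finite_tensor (matmul_tensor n m p)"
  by (simp add: finite_tensor_def matmul_tensor_def)

lemma finite_tensor_diag: "finite_tensor (diag_tensor r)"
  by (simp add: finite_tensor_def diag_tensor_def)

lemma finite_tensor_plus: "finite_tensor S \<Longrightarrow> finite_tensor T \<Longrightarrow> finite_tensor (S \<oplus> T)"
  by (simp add: finite_tensor_def tensor_plus_def)

lemma finite_tensor_dsum:
  "finite A \<Longrightarrow> (\<And>s. s \<in> A \<Longrightarrow> finite_tensor (T s)) \<Longrightarrow> finite_tensor (tensor_dsum A T)"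
  by (simp add: finite_tensor_def tensor_dsum_def)

text \<open>
  The matrix \<open>u\<close> in the block \<open>(\<alpha>, \<beta>)\<close> is spanned by the products of \<open>balanced na (\<alpha>, a)\<close> in
  the row index and \<open>unit_vec (\<beta>, b)\<close> in the column index, and \<open>v\<close> by the same with the roles
  exchanged.  Rows and columns are indexed by pairs (block, position).
\<close>

abbreviation unit_vec :: "'b \<Rightarrow> 'b \<Rightarrow> 'c::zero_neq_one" where
  "unit_vec p x \<equiv> of_bool (x = p)"

definition balanced :: "('b \<Rightarrow> nat) \<Rightarrow> 'b \<times> nat \<Rightarrow> 'b \<times> nat \<Rightarrow> 'c::ring_1" where
  "balanced na p x = unit_vec p x - unit_vec (fst p, na (fst p)) x"

text \<open>The entries 1 and -1 lie in the same block, so both are counted or neither is.\<close>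

lemma sum_balanced_block:
  assumes "finite P" and "p \<in> P" and "(fst p, na (fst p)) \<in> P"
  shows "(\<Sum>x\<in>P. balanced na p x * of_bool (fst x = c)) = (0 :: 'c::ring_1)"
  using assms
  by (simp add: balanced_def left_diff_distrib sum_subtractf sum_of_bool_eq_mult
    del: sum_of_bool_mult_eq sum_mult_of_bool_eq)

text \<open>Since \<open>p\<close> is not last in its block, it misses the entry -1 of
  \<open>balanced na p'\<close>; only the entry 1 at \<open>p'\<close> can meet it.\<close>

lemma sum_unit_vec_balanced_block:
  assumes "finite P" and "p \<in> P" and "snd p \<noteq> na (fst p)"
  shows "(\<Sum>x\<in>P. unit_vec p x * balanced na p' x * of_bool (fst x = c)) =
    (of_bool (p = p' \<and> fst p = c) :: 'c::ring_1)"
  using assms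
  by (cases p; cases p') (auto simp: mult.assoc sum_of_bool_eq_mult balanced_def
    simp del: sum_of_bool_mult_eq sum_mult_of_bool_eq)

text \<open>The diagonal terms are enumerated by pairs in \<open>P \<times> Q\<close> and all
  coefficients factor, so the sum over pairs is a product of two sums.\<close>

lemma trilinear_diag_bij_betw:
  assumes "bij_betw h {1..r} (P \<times> Q)"
  shows "trilinear (diag_tensor r)
      (\<lambda>i. cx * (x1 (fst (h i)) * x2 (snd (h i))))
      (\<lambda>i. cy * (y1 (fst (h i)) * y2 (snd (h i))))
      (\<lambda>i. cz * (z1 (fst (h i)) * z2 (snd (h i)))) =
    cx * cy * cz * ((\<Sum>p\<in>P. x1 p * y1 p * z1 p) * (\<Sum>p\<in>Q. x2 p * y2 p * z2 p))"
    (is "?lhs = ?rhs")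
proof -
  let ?F = "\<lambda>(p, p'). cx * cy * cz * ((x1 p * y1 p * z1 p) * (x2 p' * y2 p' * z2 p'))"
  have "?lhs = (\<Sum>i=1..r. ?F (h i))"
    unfolding trilinear_diag by (rule sum.cong) (auto simp: split_beta mult_ac)
  also have "\<dots> = (\<Sum>w \<in> P \<times> Q. ?F w)"
    using assms by (rule sum.reindex_bij_betw)
  also have "\<dots> = (\<Sum>p\<in>P. \<Sum>p'\<in>Q. ?F (p, p'))"
    by (simp add: sum.cartesian_product)
  also have "\<dots> = ?rhs"
    by (subst sum_product) (simp add: sum_distrib_left)
  finally show ?thesis .
qed

lemma sum_of_bool_outer:
  fixes x y :: "nat \<Rightarrow> 'c::comm_semiring_1"
  assumes "c \<in> {1..p}" and "c' \<in> {1..q}"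
  shows "(\<Sum>a=1..p. \<Sum>b=1..q. x a * y b * of_bool (a = c \<and> b = c')) = x c * y c'"
proof -
  have "(\<Sum>a=1..p. \<Sum>b=1..q. x a * y b * of_bool (a = c \<and> b = c')) =
      (\<Sum>a=1..p. \<Sum>b=1..q. of_bool (b = c') * (of_bool (a = c) * (x a * y b)))"
    by (intro sum.cong) auto
  with assms show ?thesis
    by (simp add: sum_of_bool_eq_mult del: sum_of_bool_mult_eq sum_mult_of_bool_eq)
qed

type_synonym result_index = "(nat \<times> nat) + ((nat \<times> nat) \<times> nat \<times> nat)"

theorem theorem7p12:
  fixes p q n m :: nat
    and na mb :: "nat \<Rightarrow> nat"
  assumes "p > 0" and "q > 0"
    and "\<And>\<alpha>. \<alpha> \<in> {1..p} \<Longrightarrow> na \<alpha> > 0"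
    and "\<And>\<beta>. \<beta> \<in> {1..q} \<Longrightarrow> mb \<beta> > 0"
    and "n = (\<Sum>\<alpha>=1..p. na \<alpha>)"
    and "m = (\<Sum>\<beta>=1..q. mb \<beta>)"
  shows "(matmul_tensor n 1 m :: (_, _, _, 'a::field) tensor) \<oplus>
           tensor_dsum ({1..p} \<times> {1..q})
             (\<lambda>(\<alpha>, \<beta>). matmul_tensor 1 ((na \<alpha> - 1) * (mb \<beta> - 1)) 1)
         \<unlhd> diag_tensor (n * m) \<oplus> matmul_tensor p 1 q"
    (is "?T \<unlhd> ?S")
proof -
  define P where "P = (SIGMA \<alpha>:{1..p}. {1..na \<alpha>})"
  define Q where "Q = (SIGMA \<beta>:{1..q}. {1..mb \<beta>})"
  have fin [simp]: "finite P" "finite Q"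
    by (simp_all add: P_def Q_def)
  have card: "card P = n" "card Q = m"
    by (simp_all add: P_def Q_def assms(5,6))
  obtain f where f: "bij_betw f {1..n} P"
    using finite_same_card_bij[of "{1..n}" P] card by auto
  obtain g where g: "bij_betw g {1..m} Q"
    using finite_same_card_bij[of "{1..m}" Q] card by auto
  obtain h where h: "bij_betw h {1..n * m} (P \<times> Q)"
    using finite_same_card_bij[of "{1..n * m}" "P \<times> Q"] card by (auto simp: card_cartesian_product)
  \<comment> \<open>The map \<open>e s\<close> lists the free positions of block \<open>s\<close>,
    those off its last row and last column; they match the inner index of the small tensor.\<close>
  have "\<forall>s. \<exists>e. bij_betw e {1..(na (fst s) - 1) * (mb (snd s) - 1)}
      ({1..<na (fst s)} \<times> {1..<mb (snd s)})"
    by (intro allI finite_same_card_bij) (auto simp: card_cartesian_product)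
  then obtain e where e: "\<And>s. bij_betw (e s) {1..(na (fst s) - 1) * (mb (snd s) - 1)}
      ({1..<na (fst s)} \<times> {1..<mb (snd s)})"
    by metis
  define row where "row s t = (fst s, fst (e s t))" for s t
  define col where "col s t = (snd s, snd (e s t))" for s t

  txt \<open>
    Up to a power of \<open>\<epsilon>\<close>, the coefficient of a variable in the rank-one term at row \<open>v\<close> and column
    \<open>w\<close> is a product such as \<open>x1 i v * x2 i w\<close>, so the sum over these terms splits into a row sum
    and a column sum.  The coefficients in the correction term are \<open>x0\<close>, \<open>y0\<close>, \<open>z0\<close>; its sign is
    carried by \<open>x0\<close>.
  \<close>
  define \<epsilon> :: "'a poly" where "\<epsilon> = monom 1 1"
  define x0 :: "result_index \<Rightarrow> nat \<Rightarrow> 'a poly" where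
    "x0 i a = (case i of Inl (i, _) \<Rightarrow> - of_bool (fst (f i) = a) | Inr _ \<Rightarrow> 0)" for i a
  define y0 :: "result_index \<Rightarrow> nat \<Rightarrow> 'a poly" where
    "y0 j b = (case j of Inl (_, j) \<Rightarrow> of_bool (fst (g j) = b) | Inr _ \<Rightarrow> 0)" for j b
  \<comment> \<open>The third index of the outer product is (column block, row block), whereas
    \<open>s\<close> is (row block, column block); hence the crossed comparison.\<close>
  define z0 :: "result_index \<Rightarrow> nat \<times> nat \<Rightarrow> 'a poly" where
    "z0 k w = (case k of Inl _ \<Rightarrow> 0 | Inr (s, _) \<Rightarrow> of_bool (snd w = fst s \<and> fst w = snd s))" for k w
  \<comment> \<open>The same scale serves the second factor: \<open>u\<close> and \<open>v\<close>
    each carry one \<epsilon>.\<close>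
  define cx where "cx i = (case i of Inl _ \<Rightarrow> 1 | Inr _ \<Rightarrow> \<epsilon>)" for i :: result_index
  define cz where "cz k = (case k of Inl _ \<Rightarrow> \<epsilon> ^ 2 | Inr _ \<Rightarrow> 1)" for k :: result_index
  define x1 :: "result_index \<Rightarrow> nat \<times> nat \<Rightarrow> 'a poly" where
    "x1 i = (case i of Inl (i, _) \<Rightarrow> unit_vec (f i) | Inr (s, _, t) \<Rightarrow> balanced na (row s t))" for i
  define x2 :: "result_index \<Rightarrow> nat \<times> nat \<Rightarrow> 'a poly" where
    "x2 i = (case i of Inl _ \<Rightarrow> (\<lambda>_. 1) | Inr (s, _, t) \<Rightarrow> unit_vec (col s t))" for i
  define y1 :: "result_index \<Rightarrow> nat \<times> nat \<Rightarrow> 'a poly" where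
    "y1 j = (case j of Inl _ \<Rightarrow> (\<lambda>_. 1) | Inr (s, t, _) \<Rightarrow> unit_vec (row s t))" for j
  define y2 :: "result_index \<Rightarrow> nat \<times> nat \<Rightarrow> 'a poly" where
    "y2 j = (case j of Inl (_, j) \<Rightarrow> unit_vec (g j) | Inr (s, t, _) \<Rightarrow> balanced mb (col s t))" for j
  define z1 :: "result_index \<Rightarrow> nat \<times> nat \<Rightarrow> 'a poly" where
    "z1 k = (case k of Inl (_, i) \<Rightarrow> unit_vec (f i) | Inr (s, _) \<Rightarrow> (\<lambda>w. of_bool (fst w = fst s)))" for k
  define z2 :: "result_index \<Rightarrow> nat \<times> nat \<Rightarrow> 'a poly" where
    "z2 k = (case k of Inl (j, _) \<Rightarrow> unit_vec (g j) | Inr (s, _) \<Rightarrow> (\<lambda>w. of_bool (fst w = snd s)))" for k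
  define A where "A i = case_sum (\<lambda>r. cx i * (x1 i (fst (h r)) * x2 i (snd (h r))))
    (\<lambda>w :: nat \<times> nat. x0 i (fst w))" for i
  define B where "B j = case_sum (\<lambda>r. cx j * (y1 j (fst (h r)) * y2 j (snd (h r))))
    (\<lambda>w :: nat \<times> nat. y0 j (snd w))" for j
  define C where "C k = case_sum (\<lambda>r. cz k * (z1 k (fst (h r)) * z2 k (snd (h r)))) (z0 k)" for k
  define \<Phi> where "\<Phi> i j k = trilinear ?S (A i) (B j) (C k)" for i j k

  have form: "\<Phi> i j k =
      cx i * cx j * cz k * ((\<Sum>w\<in>P. x1 i w * y1 j w * z1 k w) * (\<Sum>w\<in>Q. x2 i w * y2 j w * z2 k w)) +
      (\<Sum>a=1..p. \<Sum>b=1..q. x0 i a * y0 j b * z0 k (b, a))" for i j k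
    unfolding \<Phi>_def trilinear_plus[OF finite_tensor_diag finite_tensor_matmul] trilinear_outer
    by (simp add: A_def B_def C_def o_def trilinear_diag_bij_betw[OF h])

  have fP: "f i \<in> P" if "i \<in> {1..n}" for i using f that by (auto dest: bij_betwE)
  have gQ: "g j \<in> Q" if "j \<in> {1..m}" for j using g that by (auto dest: bij_betwE)
  have f_inj: "f i = f i' \<longleftrightarrow> i = i'" if "i \<in> {1..n}" "i' \<in> {1..n}" for i i'
    using inj_on_eq_iff[OF bij_betw_imp_inj_on[OF f]] that by blast
  have g_inj: "g i = g i' \<longleftrightarrow> i = i'" if "i \<in> {1..m}" "i' \<in> {1..m}" for i i'
    using inj_on_eq_iff[OF bij_betw_imp_inj_on[OF g]] that by blast
  have last: "\<alpha> \<in> {1..p} \<Longrightarrow> (\<alpha>, na \<alpha>) \<in> P" "\<beta> \<in> {1..q} \<Longrightarrow> (\<beta>, mb \<beta>) \<in> Q" for \<alpha> \<beta>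
    using assms(3)[of \<alpha>] assms(4)[of \<beta>] by (auto simp: P_def Q_def)
  have rowcol: "row s t \<in> P" "col s t \<in> Q" "snd (row s t) \<noteq> na (fst (row s t))"
      "snd (col s t) \<noteq> mb (fst (col s t))"
    if "s \<in> {1..p} \<times> {1..q}" "t \<in> {1..(na (fst s) - 1) * (mb (snd s) - 1)}" for s t
    using bij_betwE[OF e[of s]] that by (fastforce simp: row_def col_def P_def Q_def)+
  have rowcol_inj: "row s t = row s t' \<and> col s t = col s t' \<longleftrightarrow> t = t'"
    if "t \<in> {1..(na (fst s) - 1) * (mb (snd s) - 1)}" "t' \<in> {1..(na (fst s) - 1) * (mb (snd s) - 1)}"
    for s t t'
    using inj_on_eq_iff[OF bij_betw_imp_inj_on[OF e[of s]] that] by (simp add: row_def col_def prod_eq_iff)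

  note simps = x0_def y0_def z0_def cx_def cz_def x1_def x2_def y1_def y2_def z1_def z2_def
  note delta = sum_of_bool_eq_mult
  have idx1: "(\<exists>i'\<in>{1..n}. i = Inl (i', 1)) \<or>
      (\<exists>s\<in>{1..p} \<times> {1..q}. \<exists>t\<in>{1..(na (fst s) - 1) * (mb (snd s) - 1)}. i = Inr (s, 1, t))"
    if "i \<in> idx1 ?T" for i
    using that by (fastforce simp: tensor_plus_def tensor_dsum_def matmul_tensor_def)
  have idx2: "(\<exists>j'\<in>{1..m}. j = Inl (1, j')) \<or>
      (\<exists>s\<in>{1..p} \<times> {1..q}. \<exists>t\<in>{1..(na (fst s) - 1) * (mb (snd s) - 1)}. j = Inr (s, t, 1))"
    if "j \<in> idx2 ?T" for j
    using that by (fastforce simp: tensor_plus_def tensor_dsum_def matmul_tensor_def)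
  have idx3: "(\<exists>j\<in>{1..m}. \<exists>i\<in>{1..n}. k = Inl (j, i)) \<or>
      (\<exists>s\<in>{1..p} \<times> {1..q}. k = Inr (s, 1, 1))"
    if "k \<in> idx3 ?T" for k
    using that by (fastforce simp: tensor_plus_def tensor_dsum_def matmul_tensor_def)

  have eps: "monom 1 3 = \<epsilon> * \<epsilon>\<^sup>2" "monom 1 2 = \<epsilon>\<^sup>2"
    by (simp_all add: \<epsilon>_def power2_eq_square mult_monom numeral_eq_Suc)

  \<comment> \<open>Coefficients up to order two, by type of variable\<close>
  have order2: "monom 1 (Suc 2) dvd \<Phi> i j k - monom (cf ?T i j k) 2"
    if i: "i \<in> idx1 ?T" and j: "j \<in> idx2 ?T" and k: "k \<in> idx3 ?T" for i j k
    using idx1[OF i]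
  proof (elim disjE bexE)
    fix i' assume i': "i' \<in> {1..n}" "i = Inl (i', 1)"
    show ?thesis
      using idx2[OF j]
    proof (elim disjE bexE)
      fix j' assume j': "j' \<in> {1..m}" "j = Inl (1, j')"
      show ?thesis
        using idx3[OF k]
      proof (elim disjE bexE)
        fix j'' i'' assume k': "j'' \<in> {1..m}" "i'' \<in> {1..n}" "k = Inl (j'', i'')"
        then have "\<Phi> i j k = monom (cf ?T i j k) 2"
          using i' j' fP gQ f_inj g_inj
          by (auto simp: form simps delta tensor_plus_def matmul_tensor_def eps
            simp del: sum_of_bool_mult_eq sum_mult_of_bool_eq)
        then show ?thesis by simp
      next
        fix s assume k': "s \<in> {1..p} \<times> {1..q}" "k = Inr (s, 1, 1)"
        \<comment> \<open>Order 0: the rank-one terms give 1 exactly when row \<open>i'\<close> and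
          column \<open>j'\<close> lie in block \<open>s\<close>, and the correction cancels
          this.\<close>
        then have "(\<Sum>a=1..p. \<Sum>b=1..q. x0 i a * y0 j b * z0 k (b, a)) = x0 i (fst s) * y0 j (snd s)"
          using sum_of_bool_outer[of "fst s" p "snd s" q "x0 i" "y0 j"] by (auto simp: z0_def)
        with i' j' k' fP gQ have "\<Phi> i j k = monom (cf ?T i j k) 2"
          unfolding form
          by (simp add: simps delta tensor_plus_def del: sum_of_bool_mult_eq sum_mult_of_bool_eq)
        then show ?thesis by simp
      qed
    next
      fix s t
      assume j': "s \<in> {1..p} \<times> {1..q}" "t \<in> {1..(na (fst s) - 1) * (mb (snd s) - 1)}"
        "j = Inr (s, t, 1)"
      show ?thesis
        using idx3[OF k]
      proof (elim disjE bexE)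
        fix j'' i'' assume k': "j'' \<in> {1..m}" "i'' \<in> {1..n}" "k = Inl (j'', i'')"
        \<comment> \<open>Here \<open>v\<close> brings \<epsilon> and \<open>z\<close> brings its
          square, so the value goes into the error term.\<close>
        then show ?thesis
          using i' j' by (simp add: form simps tensor_plus_def eps)
      next
        fix s' assume k': "s' \<in> {1..p} \<times> {1..q}" "k = Inr (s', 1, 1)"
        have blk: "fst (col s t) \<in> {1..q}" using j' by (auto simp: col_def)
        \<comment> \<open>Order 1 vanishes because \<open>v\<close> is balanced over the columns of
          each block.\<close>
        have "(\<Sum>w\<in>Q. x2 i w * y2 j w * z2 k w) = 0"
          using i' j' k'
            sum_balanced_block[where na = mb, OF fin(2) rowcol(2)[OF j'(1,2)] last(2)[OF blk]]
          by (simp add: simps)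
        then have "\<Phi> i j k = 0"
          using j' by (simp only: form) (simp add: y0_def)
        then show ?thesis
          using i' j' k' by (simp add: tensor_plus_def)
      qed
    qed
  next
    fix s t
    assume i': "s \<in> {1..p} \<times> {1..q}" "t \<in> {1..(na (fst s) - 1) * (mb (snd s) - 1)}"
      "i = Inr (s, 1, t)"
    show ?thesis
      using idx2[OF j]
    proof (elim disjE bexE)
      fix j' assume j': "j' \<in> {1..m}" "j = Inl (1, j')"
      show ?thesis
        using idx3[OF k]
      proof (elim disjE bexE)
        fix j'' i'' assume k': "j'' \<in> {1..m}" "i'' \<in> {1..n}" "k = Inl (j'', i'')"
        then show ?thesis
          using i' j' by (simp add: form simps tensor_plus_def eps)
      next
        fix s' assume k': "s' \<in> {1..p} \<times> {1..q}" "k = Inr (s', 1, 1)"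
        have blk: "fst (row s t) \<in> {1..p}" using i' by (auto simp: row_def)
        \<comment> \<open>Likewise \<open>u\<close> is balanced over the rows of each block.\<close>
        have "(\<Sum>w\<in>P. x1 i w * y1 j w * z1 k w) = 0"
          using i' j' k'
            sum_balanced_block[where na = na, OF fin(1) rowcol(1)[OF i'(1,2)] last(1)[OF blk]]
          by (simp add: simps)
        then have "\<Phi> i j k = 0"
          using i' by (simp only: form) (simp add: x0_def)
        then show ?thesis
          using i' j' k' by (simp add: tensor_plus_def)
      qed
    next
      fix s' t'
      assume j': "s' \<in> {1..p} \<times> {1..q}" "t' \<in> {1..(na (fst s') - 1) * (mb (snd s') - 1)}"
        "j = Inr (s', t', 1)"
      show ?thesis
        using idx3[OF k]
      proof (elim disjE bexE)
        fix j'' i'' assume k': "j'' \<in> {1..m}" "i'' \<in> {1..n}" "k = Inl (j'', i'')"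
        then show ?thesis
          using i' j' by (simp add: form simps tensor_plus_def eps mult_ac)
      next
        fix s'' assume k': "s'' \<in> {1..p} \<times> {1..q}" "k = Inr (s'', 1, 1)"
        have "(\<Sum>w\<in>P. x1 i w * y1 j w * z1 k w) =
            (\<Sum>w\<in>P. unit_vec (row s' t') w * balanced na (row s t) w * of_bool (fst w = fst s''))"
          using i' j' k' by (simp add: simps mult.commute)
        also have "\<dots> = of_bool (row s' t' = row s t \<and> fst s' = fst s'')"
          by (subst sum_unit_vec_balanced_block[where na = na, OF fin(1) rowcol(1,3)[OF j'(1,2)]])
            (simp add: row_def)
        finally have r: "(\<Sum>w\<in>P. x1 i w * y1 j w * z1 k w) = \<dots>" .
        have "(\<Sum>w\<in>Q. x2 i w * y2 j w * z2 k w) =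
            (\<Sum>w\<in>Q. unit_vec (col s t) w * balanced mb (col s' t') w * of_bool (fst w = snd s''))"
          using i' j' k' by (simp add: simps)
        also have "\<dots> = of_bool (col s t = col s' t' \<and> snd s = snd s'')"
          by (subst sum_unit_vec_balanced_block[where na = mb, OF fin(2) rowcol(2,4)[OF i'(1,2)]])
            (simp add: col_def)
        finally have c: "(\<Sum>w\<in>Q. x2 i w * y2 j w * z2 k w) = \<dots>" .
        \<comment> \<open>Row and column together determine the block, and then injectivity of
          \<open>e s\<close> determines the position.\<close>
        have st: "row s' t' = row s t \<and> fst s' = fst s'' \<and> col s t = col s' t' \<and> snd s = snd s'' \<longleftrightarrow>
            s = s' \<and> s' = s'' \<and> t = t'" (is "?l \<longleftrightarrow> ?r")
        proof
          assume l: ?l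
          then have "s = s'" "s' = s''" by (auto simp: row_def col_def prod_eq_iff)
          moreover from this l have "t = t'" using rowcol_inj i'(2) j'(2) by metis
          ultimately show ?r by simp
        qed auto
        have "\<Phi> i j k = \<epsilon>\<^sup>2 * of_bool (s = s' \<and> s' = s'' \<and> t = t')"
          unfolding form r c st[symmetric]
          using i' j' k' by (simp add: x0_def cx_def cz_def power2_eq_square of_bool_conj)
        also have "\<dots> = monom (cf ?T i j k) 2"
          using i' j' k'
          by (auto simp: tensor_plus_def tensor_dsum_def matmul_tensor_def eps split: prod.splits)
        finally show ?thesis by simp
      qed
    qed
  qed
  show ?thesis
  proof (rule degenerationI)
    show "finite_tensor ?T"
      by (auto intro!: finite_tensor_plus finite_tensor_dsum finite_tensor_matmul)
    show "finite_tensor ?S"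
      by (intro finite_tensor_plus finite_tensor_diag finite_tensor_matmul)
  qed (rule order2[unfolded \<Phi>_def])
qed

end
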